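(* Let $(\mathfrak g,J_M)$ be a $6$-dimensional real nilpotent Lie algebra with a 1-abelian complex structure, where $M\in M_2(\mathbb C)$ is a regular (invertible) non-Hermitian matrix. Then there exists a basis $\{\sigma^i\}_{i=1}^3$ of $\mathfrak g^{1,0}$ such that the complex structure equations are one of the following: (a) $J^3_{r1}$: $d\sigma^1=d\sigma^2=0$, $d\sigma^3=\sigma^{1\bar 2}+\sigma^{2\bar 1}+i\sigma^{2\bar 2}$; (b) $J^3_{r2}$: $d\sigma^1=d\sigma^2=0$, $d\sigma^3=\sigma^{1\bar 2}+\mu\,\sigma^{2\bar 1}$ for $\mu\in\mathbb R$, $1<\mu<+\infty$; (c) $J^3_{r3}$: $d\sigma^1=d\sigma^2=0$, $d\sigma^3=\sigma^{1\bar 1}+\lambda\,\sigma^{2\bar 2}$ for $\lambda=e^{i\theta}$, $\theta\in(0,\pi)$.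
   Context: For a complex structure $J$ on a real Lie algebra $\mathfrak g$, $\mathfrak g^{1,0}\subset\mathfrak g^*_{\mathbb C}$ is the space of $(1,0)$-forms and $d$ is the Chevalley–Eilenberg differential. We write $\sigma^{j\bar k}=\sigma^j\wedge\overline{\sigma^k}$. $J$ is abelian if $[Jx,Jy]=[x,y]$ for all $x,y$. An abelian complex structure on a $2n$-dimensional nilpotent Lie algebra is 1-abelian if $h^{1,0}=\dim H^{1,0}_{\bar\partial}(\mathfrak g)=\dim\ker(\bar\partial:\mathfrak g^{1,0}\to\bigwedge^{1,1}\mathfrak g^* )$ equals $n-1$. For every 1-abelian complex structure there are a basis $\{\omega^i\}_{i=1}^n$ of $\mathfrak g^{1,0}$ and a nonzero $M\in M_{n-1}(\mathbb C)$ with $d\omega^1=\dots=d\omega^{n-1}=0$ and $d\omega^n=\sum_{j,k=1}^{n-1}M_{jk}\,\omega^{j\bar k}$; the structure is then denoted $J_M$. A matrix $M$ is Hermitian if $M=\bar M^T$.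
   Formalization: "M non-Hermitian" is read as: no basis of (1,0)-forms presents J as J_M' with M' Hermitian; for the given M alone the claim fails, e.g. for M = i·Id, which is invertible and non-Hermitian but equivalent to none of (a), (b), (c). *)

theory Defs
  imports "HOL-Analysis.Analysis" "HOL-Library.Function_Algebras"
begin

section \<open>Real Lie algebras\<close>

text \<open>The underlying real vector space of a Lie algebra is a type \<open>'a\<close> of class
  \<open>real_vector\<close>; its bracket \<open>br\<close> and complex structure \<open>J\<close> are explicit parameters.\<close>

definition lie_algebra :: "('a::real_vector \<Rightarrow> 'a \<Rightarrow> 'a) \<Rightarrow> bool" where
  "lie_algebra br \<longleftrightarrow>
     (\<forall>x. linear (br x)) \<and> (\<forall>y. linear (\<lambda>x. br x y)) \<and>
     (\<forall>x. br x x = 0) \<and>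
     (\<forall>x y z. br x (br y z) + br y (br z x) + br z (br x y) = 0)"

primrec lower_central :: "('a::real_vector \<Rightarrow> 'a \<Rightarrow> 'a) \<Rightarrow> nat \<Rightarrow> 'a set" where
  "lower_central br 0 = UNIV"
| "lower_central br (Suc k) = span {br x y | x y. y \<in> lower_central br k}"

definition nilpotent_lie_algebra :: "('a::real_vector \<Rightarrow> 'a \<Rightarrow> 'a) \<Rightarrow> bool" where
  "nilpotent_lie_algebra br \<longleftrightarrow> lie_algebra br \<and> (\<exists>k. lower_central br k = {0})"

definition complex_structure :: "('a::real_vector \<Rightarrow> 'a \<Rightarrow> 'a) \<Rightarrow> ('a \<Rightarrow> 'a) \<Rightarrow> bool" where
  "complex_structure br J \<longleftrightarrow>
     linear J \<and> (\<forall>x. J (J x) = - x) \<and>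
     (\<forall>x y. br (J x) (J y) - J (br (J x) y) - J (br x (J y)) - br x y = 0)"

definition abelian_complex_structure :: "('a::real_vector \<Rightarrow> 'a \<Rightarrow> 'a) \<Rightarrow> ('a \<Rightarrow> 'a) \<Rightarrow> bool" where
  "abelian_complex_structure br J \<longleftrightarrow>
     complex_structure br J \<and> (\<forall>x y. br (J x) (J y) = br x y)"


section \<open>Complex-valued forms\<close>

text \<open>The complexified dual is identified with the complex vector space of real-linear maps
  \<open>'a \<Rightarrow> complex\<close>; a complex 2-form is a function \<open>'a \<times> 'a \<Rightarrow> complex\<close>.
  Sums and zero of forms are pointwise.\<close>

definition cscale :: "complex \<Rightarrow> ('b \<Rightarrow> complex) \<Rightarrow> 'b \<Rightarrow> complex"  (infixr "*\<^sub>c" 75) where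
  "c *\<^sub>c f = (\<lambda>x. c * f x)"

interpretation form: vector_space cscale
  by unfold_locales (auto simp: cscale_def fun_eq_iff algebra_simps)

definition wedge :: "('a \<Rightarrow> complex) \<Rightarrow> ('a \<Rightarrow> complex) \<Rightarrow> 'a \<times> 'a \<Rightarrow> complex"  (infix "\<and>\<^sub>f" 80) where
  "\<alpha> \<and>\<^sub>f \<beta> = (\<lambda>(x, y). \<alpha> x * \<beta> y - \<alpha> y * \<beta> x)"

definition conj_form :: "('a \<Rightarrow> complex) \<Rightarrow> 'a \<Rightarrow> complex" where
  "conj_form \<alpha> = (\<lambda>x. cnj (\<alpha> x))"

text \<open>\<open>wbar \<sigma> j k\<close> is the form $\sigma^{j\bar k}$.\<close>

definition wbar :: "(nat \<Rightarrow> 'a \<Rightarrow> complex) \<Rightarrow> nat \<Rightarrow> nat \<Rightarrow> 'a \<times> 'a \<Rightarrow> complex" where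
  "wbar \<sigma> j k = \<sigma> j \<and>\<^sub>f conj_form (\<sigma> k)"

text \<open>The Chevalley--Eilenberg differential in degree 1.\<close>

definition ce_d :: "('a \<Rightarrow> 'a \<Rightarrow> 'a) \<Rightarrow> ('a \<Rightarrow> complex) \<Rightarrow> 'a \<times> 'a \<Rightarrow> complex" where
  "ce_d br \<alpha> = (\<lambda>(x, y). - \<alpha> (br x y))"

definition forms_10 :: "('a::real_vector \<Rightarrow> 'a) \<Rightarrow> ('a \<Rightarrow> complex) set" where
  "forms_10 J = {\<alpha>. linear \<alpha> \<and> (\<forall>x. \<alpha> (J x) = \<i> * \<alpha> x)}"

text \<open>Precomposition of a 2-form with \<open>J \<times> J\<close> is the identity on (1,1)-forms and minus the
  identity on (2,0)- and (0,2)-forms, hence the following formula for the (1,1)-component.\<close>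

definition component_11 :: "('a \<Rightarrow> 'a) \<Rightarrow> ('a \<times> 'a \<Rightarrow> complex) \<Rightarrow> 'a \<times> 'a \<Rightarrow> complex" where
  "component_11 J \<beta> = (\<lambda>(x, y). (\<beta> (x, y) + \<beta> (J x, J y)) / 2)"

definition dbar :: "('a \<Rightarrow> 'a \<Rightarrow> 'a) \<Rightarrow> ('a \<Rightarrow> 'a) \<Rightarrow> ('a \<Rightarrow> complex) \<Rightarrow> 'a \<times> 'a \<Rightarrow> complex" where
  "dbar br J \<alpha> = component_11 J (ce_d br \<alpha>)"

definition h10 :: "('a::real_vector \<Rightarrow> 'a \<Rightarrow> 'a) \<Rightarrow> ('a \<Rightarrow> 'a) \<Rightarrow> nat" where
  "h10 br J = form.dim {\<alpha> \<in> forms_10 J. dbar br J \<alpha> = 0}"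

definition basis_10 :: "('a::real_vector \<Rightarrow> 'a) \<Rightarrow> nat \<Rightarrow> (nat \<Rightarrow> 'a \<Rightarrow> complex) \<Rightarrow> bool" where
  "basis_10 J n \<sigma> \<longleftrightarrow>
     inj_on \<sigma> {1..n} \<and> form.independent (\<sigma> ` {1..n}) \<and> form.span (\<sigma> ` {1..n}) = forms_10 J"


section \<open>1-abelian complex structures\<close>

definition one_abelian :: "('a::real_vector \<Rightarrow> 'a \<Rightarrow> 'a) \<Rightarrow> ('a \<Rightarrow> 'a) \<Rightarrow> nat \<Rightarrow> bool" where
  "one_abelian br J n \<longleftrightarrow>
     nilpotent_lie_algebra br \<and> n \<ge> 1 \<and> dim (UNIV :: 'a set) = 2 * n \<and>
     abelian_complex_structure br J \<and> h10 br J = n - 1"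

definition hermitian_matrix :: "complex^'m^'m \<Rightarrow> bool" where
  "hermitian_matrix M \<longleftrightarrow> M = transpose (map_matrix cnj M)"

text \<open>\<open>presents_J br J \<omega> M\<close>: in complex dimension 3, the basis \<open>\<omega>\<close> exhibits \<open>J\<close> as $J_M$.
  The matrix is not determined by \<open>J\<close>: a change of basis replaces \<open>M\<close> by
  $c\,A^T M \bar A$ with \<open>A\<close> invertible and \<open>c \<noteq> 0\<close>. Invertibility of \<open>M\<close> does not depend on
  these choices, but being Hermitian does (rescaling $\omega^3$ turns $M$ into $\mathrm{i} M$),
  so ``\<open>J\<close> is some $J_M$ with \<open>M\<close> Hermitian'' is the basis-independent notion.\<close>

definition presents_J ::
  "('a::real_vector \<Rightarrow> 'a \<Rightarrow> 'a) \<Rightarrow> ('a \<Rightarrow> 'a) \<Rightarrow> (nat \<Rightarrow> 'a \<Rightarrow> complex) \<Rightarrow> complex^2^2 \<Rightarrow> bool" where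
  "presents_J br J \<omega> M \<longleftrightarrow>
     basis_10 J 3 \<omega> \<and> ce_d br (\<omega> 1) = 0 \<and> ce_d br (\<omega> 2) = 0 \<and>
     ce_d br (\<omega> 3) =
       M$1$1 *\<^sub>c wbar \<omega> 1 1 + M$1$2 *\<^sub>c wbar \<omega> 1 2 +
       M$2$1 *\<^sub>c wbar \<omega> 2 1 + M$2$2 *\<^sub>c wbar \<omega> 2 2"

end

theory Submission
  imports Defs
begin

text \<open>
  Writing the closed forms \<open>\<omega>\<^sup>1, \<omega>\<^sup>2\<close> in a new basis of their span by an invertible matrix \<open>P\<close>
  and multiplying \<open>\<omega>\<^sup>3\<close> by \<open>k \<noteq> 0\<close> replaces the structure matrix \<open>M\<close> by \<open>k P\<^sup>T M P'\<close>, where \<open>P'\<close>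
  is the entrywise conjugate of \<open>P\<close> (\<open>presents_J_change_basis\<close>).  The theorem is therefore a
  classification of nondegenerate sesquilinear forms \<open>B\<close> on \<open>\<complex>\<^sup>2\<close> up to congruence and a scalar
  factor: every such form is equivalent to a Hermitian one or to one of the three listed
  (\<open>normal_form_exists\<close>), and the hypothesis on \<open>J\<close> rules out the Hermitian ones.

  For the classification, compare \<open>B\<close> with its conjugate transpose \<open>B*(v, u)\<close>, the conjugate
  of \<open>B(u, v)\<close>.  The quadratic \<open>det (B - l B*)\<close> has a root \<open>l\<close>, hence there is a vector \<open>u \<noteq> 0\<close>
  with \<open>B(v, u) = l B*(v, u)\<close> for all \<open>v\<close>.  In particular \<open>B(v, u) = 0\<close> as soon as
  \<open>B(u, v) = 0\<close>, and conversely if \<open>l \<noteq> 0\<close>; the vector \<open>u\<close> does for \<open>B\<close> what any vector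
  does for a Hermitian form.

  If \<open>B(u, u) \<noteq> 0\<close>, then \<open>u\<close> splits off orthogonally and \<open>B\<close> is diagonal.  Rescaling \<open>B\<close> and the
  basis vectors leaves only the argument of the ratio of the diagonal entries, and swapping the
  vectors changes the sign of that argument (\<open>diagonal_normal_form\<close>).  This gives the family
  with parameter \<open>\<theta>\<close>, or a Hermitian form if the ratio is real.

  If \<open>B(u, u) = 0\<close>, then \<open>u\<close> is isotropic, and scaling brings the off-diagonal entries to \<open>1\<close> and
  \<open>\<mu> > 0\<close>.  Adding \<open>t u\<close> to the second vector adds \<open>t + \<mu> t'\<close> to the last entry, with \<open>t'\<close>
  the conjugate of \<open>t\<close>.  This real-linear map of \<open>t\<close> is onto unless \<open>\<mu> = 1\<close>, where its
  image is the real line (\<open>isotropic_normal_form\<close>).  Thus \<open>\<mu> \<noteq> 1\<close> leads to the family with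
  parameter \<open>\<mu>\<close>, and \<open>\<mu> = 1\<close> to the exceptional form with last entry \<open>\<i>\<close> or to a Hermitian form.
\<close>

section \<open>Binary sesquilinear forms up to congruence and a scalar factor\<close>

definition mat2 :: "complex \<Rightarrow> complex \<Rightarrow> complex \<Rightarrow> complex \<Rightarrow> complex^2^2" where
  "mat2 a b c d = vector [vector [a, b], vector [c, d]]"

lemma mat2_nth [simp]:
  "mat2 a b c d $ 1 $ 1 = a" "mat2 a b c d $ 1 $ 2 = b"
  "mat2 a b c d $ 2 $ 1 = c" "mat2 a b c d $ 2 $ 2 = d"
  by (simp_all add: mat2_def)

text \<open>The columns of \<open>P\<close> are the new basis vectors: \<open>N\<close> is \<open>k\<close> times the Gram matrix of these columns
  under the form \<open>B(u, v) = \<Sum>\<^sub>i\<^sub>j M\<^sub>i\<^sub>j u\<^sub>i cnj v\<^sub>j\<close>.\<close>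

definition scaled_congruent :: "complex^2^2 \<Rightarrow> complex^2^2 \<Rightarrow> bool" where
  "scaled_congruent M N \<longleftrightarrow> (\<exists>k P. k \<noteq> 0 \<and> det P \<noteq> 0 \<and>
     (\<forall>i j. N$i$j = k * (transpose P ** M ** map_matrix cnj P)$i$j))"

lemma scaled_congruent_trans:
  assumes "scaled_congruent L M" "scaled_congruent M N"
  shows "scaled_congruent L N"
proof -
  obtain k P where kP: "k \<noteq> 0" "det P \<noteq> 0"
    and M: "\<And>i j. M$i$j = k * (transpose P ** L ** map_matrix cnj P)$i$j"
    using assms(1) unfolding scaled_congruent_def by blast
  obtain l Q where lQ: "l \<noteq> 0" "det Q \<noteq> 0"
    and N: "\<And>i j. N$i$j = l * (transpose Q ** M ** map_matrix cnj Q)$i$j"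
    using assms(2) unfolding scaled_congruent_def by blast
  have "N$i$j = (l * k) * (transpose (P ** Q) ** L ** map_matrix cnj (P ** Q))$i$j" for i j
    unfolding N by (simp add: M matrix_matrix_mult_def transpose_def sum_2 algebra_simps)
  moreover have "l * k \<noteq> 0" "det (P ** Q) \<noteq> 0"
    using kP lQ by (simp_all add: det_mul)
  ultimately show ?thesis
    unfolding scaled_congruent_def by blast
qed

text \<open>The entrywise form of the relation, in which a new basis can be chosen by naming its two
  vectors \<open>(u1, u2)\<close> and \<open>(v1, v2)\<close>.\<close>

lemma scaled_congruent_mat2:
  assumes "k \<noteq> 0" "u1 * v2 - v1 * u2 \<noteq> 0"
  shows "scaled_congruent M (mat2
    (k * (M$1$1 * u1 * cnj u1 + M$1$2 * u1 * cnj u2 + M$2$1 * u2 * cnj u1 + M$2$2 * u2 * cnj u2))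
    (k * (M$1$1 * u1 * cnj v1 + M$1$2 * u1 * cnj v2 + M$2$1 * u2 * cnj v1 + M$2$2 * u2 * cnj v2))
    (k * (M$1$1 * v1 * cnj u1 + M$1$2 * v1 * cnj u2 + M$2$1 * v2 * cnj u1 + M$2$2 * v2 * cnj u2))
    (k * (M$1$1 * v1 * cnj v1 + M$1$2 * v1 * cnj v2 + M$2$1 * v2 * cnj v1 + M$2$2 * v2 * cnj v2)))"
  unfolding scaled_congruent_def
  by (rule exI[of _ k], rule exI[of _ "mat2 u1 v1 u2 v2"])
     (use assms in \<open>simp add: det_2 forall_2 matrix_matrix_mult_def transpose_def sum_2 algebra_simps\<close>)

lemma scaled_congruent_scale:
  assumes "k \<noteq> 0" "x \<noteq> 0" "y \<noteq> 0"
  shows "scaled_congruent (mat2 a b c d)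
    (mat2 (k * a * x * cnj x) (k * b * x * cnj y) (k * c * y * cnj x) (k * d * y * cnj y))"
  using scaled_congruent_mat2[of k x y 0 0 "mat2 a b c d"] assms by (simp add: mult.assoc)

lemma scaled_congruent_swap: "scaled_congruent (mat2 a b c d) (mat2 d c b a)"
  using scaled_congruent_mat2[of 1 0 0 1 1 "mat2 a b c d"] by simp

text \<open>Adding \<open>t\<close> times an isotropic first vector to the second one changes only the last entry
  of the Gram matrix.\<close>

lemma scaled_congruent_shear:
  "scaled_congruent (mat2 0 b c d) (mat2 0 b c (d + t * b + cnj t * c))"
  using scaled_congruent_mat2[of 1 1 1 t 0 "mat2 0 b c d"] by (simp add: algebra_simps)

section \<open>Classification of nondegenerate forms\<close>

lemma hermitian_mat2: "hermitian_matrix (mat2 a b c d) \<longleftrightarrow> a = cnj a \<and> c = cnj b \<and> d = cnj d"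
  unfolding hermitian_matrix_def by (auto simp: vec_eq_iff forall_2 transpose_def)

definition normal_form :: "complex^2^2 \<Rightarrow> bool" where
  "normal_form N \<longleftrightarrow> N = mat2 0 1 1 \<i> \<or>
     (\<exists>\<mu>::real. 1 < \<mu> \<and> N = mat2 0 1 (complex_of_real \<mu>) 0) \<or>
     (\<exists>\<theta>::real. 0 < \<theta> \<and> \<theta> < pi \<and> N = mat2 1 0 0 (exp (\<i> * complex_of_real \<theta>)))"

text \<open>Dividing by \<open>a\<close> leaves the diagonal \<open>1, d / a\<close>.  Rescaling the second vector multiplies
  the last entry by a positive real, so only the argument \<open>\<theta>\<close> of \<open>d / a\<close> survives.  Negative arguments
  become positive by swapping the vectors and normalizing again.\<close>

lemma diagonal_normal_form:
  assumes "a \<noteq> 0" "d \<noteq> 0"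
  shows "\<exists>N. scaled_congruent (mat2 a 0 0 d) N \<and> (hermitian_matrix N \<or> normal_form N)"
proof -
  define w where "w = d / a"
  define \<theta> where "\<theta> = Arg w"
  have w: "w \<noteq> 0" "w = complex_of_real (cmod w) * cis \<theta>"
    using assms rcis_cmod_Arg[of w] by (auto simp: w_def \<theta>_def rcis_def)
  \<comment> \<open>the length of the second vector that makes the last entry unimodular\<close>
  define y where "y = complex_of_real (1 / sqrt (cmod w))"
  have y0: "y \<noteq> 0"
    using w(1) by (simp add: y_def)
  have yy: "y * cnj y = 1 / complex_of_real (cmod w)"
  proof -
    have "1 / sqrt (cmod w) * (1 / sqrt (cmod w)) = 1 / cmod w"
      by simp
    then show ?thesis
      unfolding y_def complex_cnj_complex_of_real of_real_mult[symmetric] by simp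
  qed
  have "1 / a * d * y * cnj y = w * (y * cnj y)"
    by (simp add: w_def)
  also have "\<dots> = complex_of_real (cmod w) * cis \<theta> * (1 / complex_of_real (cmod w))"
    unfolding yy using w(2) by argo
  also have "\<dots> = cis \<theta>"
    using w(1) by simp
  finally have d1: "1 / a * d * y * cnj y = cis \<theta>" .
  have unit: "scaled_congruent (mat2 a 0 0 d) (mat2 1 0 0 (cis \<theta>))"
    using scaled_congruent_scale[of "1 / a" 1 y a 0 0 d] assms(1) y0 d1 by simp
  have range: "-pi < \<theta>" "\<theta> \<le> pi"
    using Arg_bounded[of w] by (auto simp: \<theta>_def)
  consider "\<theta> = 0 \<or> \<theta> = pi" | "0 < \<theta>" "\<theta> < pi" | "\<theta> < 0"
    using range by linarith
  then show ?thesis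
  proof cases
    case 1
    then have "hermitian_matrix (mat2 1 0 0 (cis \<theta>))"
      by (auto simp: hermitian_mat2)
    with unit show ?thesis by blast
  next
    case 2
    then have "normal_form (mat2 1 0 0 (cis \<theta>))"
      unfolding normal_form_def cis_conv_exp by blast
    with unit show ?thesis by blast
  next
    case 3
    have "scaled_congruent (mat2 (cis \<theta>) 0 0 1) (mat2 1 0 0 (cis (-\<theta>)))"
      using scaled_congruent_scale[of "cis (-\<theta>)" 1 1 "cis \<theta>" 0 0 1] by (simp add: cis_mult)
    then have "scaled_congruent (mat2 a 0 0 d) (mat2 1 0 0 (cis (-\<theta>)))"
      using unit scaled_congruent_swap scaled_congruent_trans by blast
    moreover have "0 < -\<theta>" "-\<theta> < pi"
      using 3 range by auto
    then have "normal_form (mat2 1 0 0 (cis (-\<theta>)))"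
      unfolding normal_form_def cis_conv_exp by blast
    ultimately show ?thesis by blast
  qed
qed

text \<open>Scaling the form and turning the second vector by a phase makes the off-diagonal entries
  \<open>1\<close> and \<open>\<mu> = |q / p|\<close>.  A shear by \<open>t\<close> then adds \<open>t + \<mu> cnj t\<close> to the last entry, that is
  \<open>(1 + \<mu>) Re t\<close> to its real part and \<open>(1 - \<mu>) Im t\<close> to its imaginary part.  Hence \<open>\<mu> = 1\<close> is
  exactly the case in which an imaginary part \<open>h\<close> cannot be removed.
  If \<open>\<mu> < 1\<close>, swapping the two vectors and normalizing again replaces \<open>\<mu>\<close> by \<open>1 / \<mu>\<close>.\<close>

lemma isotropic_normal_form:
  assumes "p \<noteq> 0" "q \<noteq> 0"
  shows "\<exists>N. scaled_congruent (mat2 0 p q r) N \<and> (hermitian_matrix N \<or> normal_form N)"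
proof -
  define w where "w = q / p"
  define \<mu> where "\<mu> = cmod w"
  \<comment> \<open>the phase \<open>y\<close> multiplies the ratio \<open>w\<close> of the off-diagonal entries by \<open>y / cnj y = y\<^sup>2\<close>\<close>
  define y where "y = cis (- Arg w / 2)"
  define k where "k = 1 / (p * cnj y)"
  have \<mu>: "\<mu> > 0"
    using assms by (simp add: \<mu>_def w_def)
  have y0: "y \<noteq> 0" "cnj y \<noteq> 0"
    by (simp_all add: y_def)
  have "y / cnj y = cis (- Arg w)"
    by (simp add: y_def cis_cnj cis_divide)
  moreover have "w = complex_of_real \<mu> * cis (Arg w)"
    using rcis_cmod_Arg[of w] by (simp add: \<mu>_def rcis_def)
  ultimately have "w * (y / cnj y) = complex_of_real \<mu>"
    by (metis (no_types) cis_mult add.right_inverse cis_zero mult.assoc mult.right_neutral)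
  then have kq: "k * q * y = complex_of_real \<mu>"
    by (simp add: k_def w_def)
  have kp: "k * p * cnj y = 1"
    using assms y0 by (simp add: k_def)
  have k0: "k \<noteq> 0"
    using assms y0 by (simp add: k_def)
  define s where "s = k * r * y * cnj y"
  have scaled: "scaled_congruent (mat2 0 p q r) (mat2 0 1 (complex_of_real \<mu>) s)"
    using scaled_congruent_scale[of k 1 y 0 p q r] k0 y0 kp kq by (simp add: s_def)
  show ?thesis
  proof (cases "\<mu> = 1")
    case False
    define t where "t = Complex (- Re s / (1 + \<mu>)) (- Im s / (1 - \<mu>))"
    have "s + t * 1 + cnj t * complex_of_real \<mu> = 0"
    proof (rule complex_eqI)
      have "Re s - Re s / (1 + \<mu>) - Re s / (1 + \<mu>) * \<mu> = 0"
        using \<mu> by (simp add: field_simps)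
      then show "Re (s + t * 1 + cnj t * complex_of_real \<mu>) = Re 0"
        by (simp add: t_def)
      have "Im s - Im s / (1 - \<mu>) + Im s / (1 - \<mu>) * \<mu> = 0"
        using False by (simp add: field_simps)
      then show "Im (s + t * 1 + cnj t * complex_of_real \<mu>) = Im 0"
        by (simp add: t_def)
    qed
    then have "scaled_congruent (mat2 0 1 (complex_of_real \<mu>) s) (mat2 0 1 (complex_of_real \<mu>) 0)"
      using scaled_congruent_shear by metis
    then have anti: "scaled_congruent (mat2 0 p q r) (mat2 0 1 (complex_of_real \<mu>) 0)"
      using scaled scaled_congruent_trans by blast
    show ?thesis
    proof (cases "\<mu> > 1")
      case True
      then have "normal_form (mat2 0 1 (complex_of_real \<mu>) 0)"
        unfolding normal_form_def by blast
      with anti show ?thesis by blast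
    next
      case small: False
      have "scaled_congruent (mat2 0 (complex_of_real \<mu>) 1 0)
              (mat2 0 1 (complex_of_real (1 / \<mu>)) 0)"
        using scaled_congruent_scale[of "1 / complex_of_real \<mu>" 1 1 0 "complex_of_real \<mu>" 1 0] \<mu>
        by simp
      then have "scaled_congruent (mat2 0 p q r) (mat2 0 1 (complex_of_real (1 / \<mu>)) 0)"
        using anti scaled_congruent_swap scaled_congruent_trans by blast
      moreover have "1 < 1 / \<mu>"
        using \<mu> small \<open>\<mu> \<noteq> 1\<close> by (simp add: field_simps)
      then have "normal_form (mat2 0 1 (complex_of_real (1 / \<mu>)) 0)"
        unfolding normal_form_def by blast
      ultimately show ?thesis by blast
    qed
  next
    case True
    define h where "h = Im s"
    define t where "t = - complex_of_real (Re s / 2)"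
    have "s + t * 1 + cnj t * 1 = \<i> * complex_of_real h"
      by (simp add: t_def h_def complex_eq_iff)
    then have "scaled_congruent (mat2 0 1 1 s) (mat2 0 1 1 (\<i> * complex_of_real h))"
      using scaled_congruent_shear by metis
    then have imag: "scaled_congruent (mat2 0 p q r) (mat2 0 1 1 (\<i> * complex_of_real h))"
      using scaled True scaled_congruent_trans by fastforce
    show ?thesis
    proof (cases "h = 0")
      case True
      then have "hermitian_matrix (mat2 0 1 1 (\<i> * complex_of_real h))"
        by (simp add: hermitian_mat2)
      with imag show ?thesis by blast
    next
      case False
      \<comment> \<open>dividing the form by the real number \<open>h\<close> also reverses its sign if \<open>h < 0\<close>; multiplying the
        isotropic vector by \<open>h\<close> restores the off-diagonal entries\<close>
      have "scaled_congruent (mat2 0 1 1 (\<i> * complex_of_real h)) (mat2 0 1 1 \<i>)"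
        using scaled_congruent_scale[of "1 / complex_of_real h" "complex_of_real h" 1
            0 1 1 "\<i> * complex_of_real h"] False by simp
      then have "scaled_congruent (mat2 0 p q r) (mat2 0 1 1 \<i>)"
        using imag scaled_congruent_trans by blast
      then show ?thesis
        unfolding normal_form_def by blast
    qed
  qed
qed

lemma singular_kernel_2:
  fixes a b c d :: "'a::field"
  assumes "a * d = b * c"
  shows "\<exists>x y. (x \<noteq> 0 \<or> y \<noteq> 0) \<and> a * x + b * y = 0 \<and> c * x + d * y = 0"
proof (cases "a = 0 \<and> b = 0")
  case True
  show ?thesis
  proof (cases "c = 0 \<and> d = 0")
    case True
    with \<open>a = 0 \<and> b = 0\<close> show ?thesis
      by (intro exI[of _ 1]) simp
  next
    case False
    with True show ?thesis
      by (intro exI[of _ d] exI[of _ "-c"]) (auto simp: mult.commute)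
  qed
next
  case False
  then show ?thesis
    using assms by (intro exI[of _ b] exI[of _ "-a"]) (auto simp: algebra_simps)
qed

lemma quadratic_root_exists:
  fixes a b c :: complex
  assumes "a \<noteq> 0"
  shows "\<exists>x. a * x\<^sup>2 + b * x + c = 0"
proof
  define s where "s = csqrt (b\<^sup>2 - 4 * a * c)"
  define x where "x = (s - b) / (2 * a)"
  have "s\<^sup>2 = b\<^sup>2 - 4 * a * c" "2 * a * x = s - b"
    using assms by (simp_all add: s_def x_def)
  then have "(4 * a) * (a * x\<^sup>2 + b * x + c) = 0"
    by algebra
  then show "a * x\<^sup>2 + b * x + c = 0"
    using assms by simp
qed

text \<open>Existence of a vector \<open>u\<close> satisfying \<open>B(v, u) = l cnj B(u, v)\<close> for all \<open>v\<close> reduces the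
  general form to the diagonal and the isotropic case, according to whether \<open>B(u, u)\<close>
  vanishes.  The nondegeneracy that those cases require comes from the determinant of the Gram
  matrix, which is \<open>det M\<close> times a nonzero square modulus.\<close>

lemma normal_form_exists:
  fixes M :: "complex^2^2"
  assumes "det M \<noteq> 0"
  shows "\<exists>N. scaled_congruent M N \<and> (hermitian_matrix N \<or> normal_form N)"
proof -
  define a b c d where "a = M$1$1" "b = M$1$2" "c = M$2$1" "d = M$2$2"
  have D: "a * d - b * c \<noteq> 0"
    using assms by (simp add: det_2 a_b_c_d_def)
  have "cnj (a * d - b * c) \<noteq> 0"
    using D by (simp only: complex_cnj_zero_iff) simp
  then have D': "cnj a * cnj d - cnj b * cnj c \<noteq> 0"
    by simp
  \<comment> \<open>\<open>det (M - l M*) = 0\<close>, with \<open>M*\<close> the conjugate transpose; the leading coefficient is \<open>det M*\<close>\<close>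
  obtain l where "(cnj a * cnj d - cnj b * cnj c) * l\<^sup>2
      + (b * cnj b + c * cnj c - a * cnj d - d * cnj a) * l + (a * d - b * c) = 0"
    using quadratic_root_exists[OF D'] by blast
  then have "(a - l * cnj a) * (d - l * cnj d) = (b - l * cnj c) * (c - l * cnj b)"
    by (simp add: algebra_simps power2_eq_square)
  then obtain x y where xy: "x \<noteq> 0 \<or> y \<noteq> 0"
    "(a - l * cnj a) * x + (b - l * cnj c) * y = 0"
    "(c - l * cnj b) * x + (d - l * cnj d) * y = 0"
    using singular_kernel_2 by blast
  define B where "B u1 u2 v1 v2 = a * u1 * cnj v1 + b * u1 * cnj v2 + c * u2 * cnj v1 + d * u2 * cnj v2"
    for u1 u2 v1 v2
  have gram: "scaled_congruent M
      (mat2 (B u1 u2 u1 u2) (B u1 u2 v1 v2) (B v1 v2 u1 u2) (B v1 v2 v1 v2))"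
    if "u1 * v2 - v1 * u2 \<noteq> 0" for u1 u2 v1 v2
    using scaled_congruent_mat2[of 1 u1 v2 v1 u2 M] that by (simp add: B_def a_b_c_d_def)
  \<comment> \<open>\<open>B\<close> is conjugate-linear in its second argument, so the kernel vector enters conjugated\<close>
  define u1 u2 where "u1 = cnj x" "u2 = cnj y"
  have u0: "u1 \<noteq> 0 \<or> u2 \<noteq> 0"
    using xy(1) by (simp add: u1_u2_def)
  have flip: "B v1 v2 u1 u2 = l * cnj (B u1 u2 v1 v2)" for v1 v2
  proof -
    have "B v1 v2 u1 u2 - l * cnj (B u1 u2 v1 v2)
        = v1 * ((a - l * cnj a) * x + (b - l * cnj c) * y)
        + v2 * ((c - l * cnj b) * x + (d - l * cnj d) * y)"
      by (simp add: B_def u1_u2_def algebra_simps)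
    then show ?thesis
      by (simp add: xy)
  qed
  have gram_det: "B u1 u2 u1 u2 * B v1 v2 v1 v2 - B u1 u2 v1 v2 * B v1 v2 u1 u2
      = (a * d - b * c) * (u1 * v2 - v1 * u2) * cnj (u1 * v2 - v1 * u2)" for v1 v2
    unfolding B_def complex_cnj_diff complex_cnj_mult by algebra
  have nondeg: "B u1 u2 u1 u2 * B v1 v2 v1 v2 \<noteq> B u1 u2 v1 v2 * B v1 v2 u1 u2"
    if "u1 * v2 - v1 * u2 \<noteq> 0" for v1 v2
    using gram_det[of v1 v2] D that
    by (metis complex_cnj_zero_iff mult_eq_0_iff right_minus_eq)
  show ?thesis
  proof (cases "B u1 u2 u1 u2 = 0")
    case False
    \<comment> \<open>\<open>B(v, u) = v1 (a x + b y) + v2 (c x + d y)\<close>, and this choice of \<open>v\<close> makes it vanish\<close>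
    define v1 v2 where "v1 = c * x + d * y" "v2 = - (a * x + b * y)"
    have vu: "B v1 v2 u1 u2 = 0"
      by (simp add: B_def u1_u2_def v1_v2_def algebra_simps)
    have "v1 \<noteq> 0 \<or> v2 \<noteq> 0"
    proof (rule ccontr)
      assume "\<not> ?thesis"
      then have "v1 = 0" "- v2 = 0" by simp_all
      then have "c * x + d * y = 0" "a * x + b * y = 0"
        unfolding v1_v2_def by (simp_all only: minus_minus)
      then have "(a * d - b * c) * x = 0" "(a * d - b * c) * y = 0"
        by algebra+
      with D xy(1) show False by simp
    qed
    moreover have "B v1 v2 u1 u2 * u1 - B u1 u2 u1 u2 * v1
          = (u1 * v2 - v1 * u2) * (c * cnj u1 + d * cnj u2)"
         "B v1 v2 u1 u2 * u2 - B u1 u2 u1 u2 * v2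
          = - (u1 * v2 - v1 * u2) * (a * cnj u1 + b * cnj u2)"
      unfolding B_def by algebra+
    \<comment> \<open>if \<open>v\<close> were proportional to \<open>u\<close>, then \<open>B(v, u) u = B(u, u) v\<close>, forcing \<open>v = 0\<close>\<close>
    ultimately have indep: "u1 * v2 - v1 * u2 \<noteq> 0"
      using vu False by auto
    have "B u1 u2 v1 v2 = 0"
    proof -
      have "l \<noteq> 0"
        using flip[of u1 u2] False by auto
      then show ?thesis
        using flip[of v1 v2] vu by simp
    qed
    with gram[OF indep] vu
    have "scaled_congruent M (mat2 (B u1 u2 u1 u2) 0 0 (B v1 v2 v1 v2))"
      by simp
    moreover have "B v1 v2 v1 v2 \<noteq> 0"
      using nondeg[OF indep] vu by auto
    ultimately show ?thesis
      using diagonal_normal_form[OF False] scaled_congruent_trans by blast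
  next
    case True
    \<comment> \<open>any complement of \<open>u\<close> would do; for this one the determinant is \<open>|u1|\<^sup>2 + |u2|\<^sup>2\<close>\<close>
    define v1 v2 where "v1 = - cnj u2" "v2 = cnj u1"
    have "u1 * v2 - v1 * u2 = complex_of_real ((cmod u1)\<^sup>2 + (cmod u2)\<^sup>2)"
      unfolding of_real_add complex_norm_square by (simp add: v1_v2_def mult.commute)
    moreover have "(cmod u1)\<^sup>2 + (cmod u2)\<^sup>2 \<noteq> 0"
      using u0 by (simp add: sum_power2_eq_zero_iff)
    ultimately have indep: "u1 * v2 - v1 * u2 \<noteq> 0"
      by (metis of_real_eq_0_iff)
    with gram True
    have "scaled_congruent M (mat2 0 (B u1 u2 v1 v2) (B v1 v2 u1 u2) (B v1 v2 v1 v2))"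
      by metis
    moreover have "B u1 u2 v1 v2 \<noteq> 0" "B v1 v2 u1 u2 \<noteq> 0"
      using nondeg[OF indep] True by auto
    ultimately show ?thesis
      using isotropic_normal_form scaled_congruent_trans by blast
  qed
qed

section \<open>Change of basis for structure equations\<close>

text \<open>Coefficient triples make the invariance of the basis property under an invertible
  substitution a matter of comparing coefficients, with no dimension count.\<close>

lemma basis_10_3_iff:
  "basis_10 J 3 \<sigma> \<longleftrightarrow>
     forms_10 J = {a *\<^sub>c \<sigma> 1 + b *\<^sub>c \<sigma> 2 + c *\<^sub>c \<sigma> 3 | a b c. True} \<and>
     (\<forall>a b c. a *\<^sub>c \<sigma> 1 + b *\<^sub>c \<sigma> 2 + c *\<^sub>c \<sigma> 3 = 0 \<longrightarrow> a = 0 \<and> b = 0 \<and> c = 0)"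
proof -
  have I: "{1..3::nat} = {1, 2, 3}"
    by auto
  have "x \<in> form.span {\<sigma> 1, \<sigma> 2, \<sigma> 3}
      \<longleftrightarrow> (\<exists>a b c. x = a *\<^sub>c \<sigma> 1 + b *\<^sub>c \<sigma> 2 + c *\<^sub>c \<sigma> 3)" for x
    by (simp add: form.span_breakdown_eq diff_eq_eq)
       (metis add.commute add.left_commute diff_eq_eq add.assoc)
  then have span: "form.span (\<sigma> ` {1..3}) = {a *\<^sub>c \<sigma> 1 + b *\<^sub>c \<sigma> 2 + c *\<^sub>c \<sigma> 3 | a b c. True}"
    unfolding I by auto
  have "inj_on \<sigma> {1..3} \<and> form.independent (\<sigma> ` {1..3}) \<longleftrightarrow>
    (\<forall>a b c. a *\<^sub>c \<sigma> 1 + b *\<^sub>c \<sigma> 2 + c *\<^sub>c \<sigma> 3 = 0 \<longrightarrow> a = 0 \<and> b = 0 \<and> c = 0)"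
    (is "?L \<longleftrightarrow> ?R")
  proof
    assume L: ?L
    show ?R
    proof (intro allI impI)
      fix a b c
      assume z: "a *\<^sub>c \<sigma> 1 + b *\<^sub>c \<sigma> 2 + c *\<^sub>c \<sigma> 3 = 0"
      have dist: "\<sigma> 1 \<noteq> \<sigma> 2" "\<sigma> 1 \<noteq> \<sigma> 3" "\<sigma> 2 \<noteq> \<sigma> 3"
        using L unfolding I by (auto simp: inj_on_def)
      define u where "u v = (if v = \<sigma> 1 then a else if v = \<sigma> 2 then b else c)" for v
      have "(\<Sum>v\<in>\<sigma> ` {1..3}. u v *\<^sub>c v) = 0"
        unfolding I using dist z by (simp add: u_def add.assoc)
      then have "\<forall>v\<in>\<sigma> ` {1..3}. u v = 0"
        using L form.independentD by blast
      then show "a = 0 \<and> b = 0 \<and> c = 0"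
        unfolding I using dist by (auto simp: u_def)
    qed
  next
    assume R: ?R
    have "\<sigma> 1 \<noteq> \<sigma> 2" using R[rule_format, of 1 "-1" 0] by (auto simp: cscale_def fun_eq_iff)
    moreover have "\<sigma> 1 \<noteq> \<sigma> 3" using R[rule_format, of 1 0 "-1"] by (auto simp: cscale_def fun_eq_iff)
    moreover have "\<sigma> 2 \<noteq> \<sigma> 3" using R[rule_format, of 0 1 "-1"] by (auto simp: cscale_def fun_eq_iff)
    ultimately have dist: "\<sigma> 1 \<noteq> \<sigma> 2" "\<sigma> 1 \<noteq> \<sigma> 3" "\<sigma> 2 \<noteq> \<sigma> 3" by auto
    have "u v = 0" if "(\<Sum>v\<in>\<sigma> ` {1..3}. u v *\<^sub>c v) = 0" "v \<in> \<sigma> ` {1..3}" for u v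
      using that dist R[rule_format, of "u (\<sigma> 1)" "u (\<sigma> 2)" "u (\<sigma> 3)"]
      unfolding I by (auto simp: add.assoc)
    then have "form.independent (\<sigma> ` {1..3})"
      using form.dependent_finite[of "\<sigma> ` {1..3}"] by auto
    moreover have "inj_on \<sigma> {1..3}"
      unfolding I using dist by (auto simp: inj_on_def)
    ultimately show ?L by blast
  qed
  then show ?thesis
    unfolding basis_10_def span by metis
qed

text \<open>Scaled congruence of structure matrices is realized by new coframes.  Expanding the old
  closed forms in the new ones, \<open>\<omega>\<^sup>j = \<Sum>\<^sub>i P\<^sub>j\<^sub>i \<sigma>\<^sup>i\<close>, turns \<open>M\<close> into \<open>P\<^sup>T M cnj P\<close>, and
  \<open>\<sigma>\<^sup>3 = k \<omega>\<^sup>3\<close> supplies the scalar.\<close>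

lemma presents_J_change_basis:
  assumes \<omega>: "presents_J br J \<omega> M" and MN: "scaled_congruent M N"
  shows "\<exists>\<sigma>. presents_J br J \<sigma> N"
proof -
  obtain k P where k: "k \<noteq> 0" and detP: "det P \<noteq> 0"
    and N: "\<And>i j. N$i$j = k * (transpose P ** M ** map_matrix cnj P)$i$j"
    using MN unfolding scaled_congruent_def by blast
  define p q r s where "p = P$1$1" "q = P$1$2" "r = P$2$1" "s = P$2$2"
  define D where "D = p * s - q * r"
  have D: "D \<noteq> 0"
    using detP by (simp add: D_def det_2 p_q_r_s_def)
  \<comment> \<open>the coefficients of \<open>\<sigma>\<^sup>1\<close> and \<open>\<sigma>\<^sup>2\<close> are the rows of \<open>P\<^sup>-\<^sup>1\<close>\<close>
  define \<sigma> :: "nat \<Rightarrow> 'a \<Rightarrow> complex" where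
    "\<sigma> i = (if i = 1 then (s / D) *\<^sub>c \<omega> 1 + (- q / D) *\<^sub>c \<omega> 2
      else if i = 2 then (- r / D) *\<^sub>c \<omega> 1 + (p / D) *\<^sub>c \<omega> 2
      else k *\<^sub>c \<omega> 3)" for i
  have \<sigma>_simps: "\<sigma> 1 = (s / D) *\<^sub>c \<omega> 1 + (- q / D) *\<^sub>c \<omega> 2"
    "\<sigma> 2 = (- r / D) *\<^sub>c \<omega> 1 + (p / D) *\<^sub>c \<omega> 2" "\<sigma> 3 = k *\<^sub>c \<omega> 3"
    by (simp_all add: \<sigma>_def)
  have \<omega>1: "\<omega> 1 x = p * \<sigma> 1 x + q * \<sigma> 2 x" for x
    using D unfolding \<sigma>_simps by (simp add: cscale_def field_simps) (simp add: D_def algebra_simps)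
  have \<omega>2: "\<omega> 2 x = r * \<sigma> 1 x + s * \<sigma> 2 x" for x
    using D unfolding \<sigma>_simps by (simp add: cscale_def field_simps) (simp add: D_def algebra_simps)
  have closed: "\<omega> 1 (br x y) = 0" "\<omega> 2 (br x y) = 0" for x y
    using \<omega> unfolding presents_J_def ce_d_def by (auto simp: fun_eq_iff)
  have d3: "- \<omega> 3 (br x y) = M$1$1 * wbar \<omega> 1 1 (x,y) + M$1$2 * wbar \<omega> 1 2 (x,y) +
       M$2$1 * wbar \<omega> 2 1 (x,y) + M$2$2 * wbar \<omega> 2 2 (x,y)" for x y
    using \<omega> unfolding presents_J_def ce_d_def by (auto simp: fun_eq_iff cscale_def)
  have "ce_d br (\<sigma> 1) = 0" "ce_d br (\<sigma> 2) = 0"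
    unfolding ce_d_def \<sigma>_simps by (auto simp: fun_eq_iff cscale_def closed simp del: One_nat_def)
  moreover have "ce_d br (\<sigma> 3) =
       N$1$1 *\<^sub>c wbar \<sigma> 1 1 + N$1$2 *\<^sub>c wbar \<sigma> 1 2 +
       N$2$1 *\<^sub>c wbar \<sigma> 2 1 + N$2$2 *\<^sub>c wbar \<sigma> 2 2"
  proof (rule ext, clarify)
    fix x y
    have "ce_d br (\<sigma> 3) (x, y) = k * (- \<omega> 3 (br x y))"
      by (simp add: ce_d_def \<sigma>_simps cscale_def)
    also have "\<dots> = (N$1$1 *\<^sub>c wbar \<sigma> 1 1 + N$1$2 *\<^sub>c wbar \<sigma> 1 2 +
       N$2$1 *\<^sub>c wbar \<sigma> 2 1 + N$2$2 *\<^sub>c wbar \<sigma> 2 2) (x, y)"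
      unfolding d3 N wbar_def wedge_def conj_form_def cscale_def
      by (simp add: \<omega>1 \<omega>2 matrix_matrix_mult_def transpose_def sum_2 p_q_r_s_def algebra_simps
          del: One_nat_def)
    finally show "ce_d br (\<sigma> 3) (x, y) = (N$1$1 *\<^sub>c wbar \<sigma> 1 1 + N$1$2 *\<^sub>c wbar \<sigma> 1 2 +
       N$2$1 *\<^sub>c wbar \<sigma> 2 1 + N$2$2 *\<^sub>c wbar \<sigma> 2 2) (x, y)" .
  qed
  moreover have "basis_10 J 3 \<sigma>"
  proof -
    have new: "a *\<^sub>c \<omega> 1 + b *\<^sub>c \<omega> 2 + c *\<^sub>c \<omega> 3
        = (a * p + b * r) *\<^sub>c \<sigma> 1 + (a * q + b * s) *\<^sub>c \<sigma> 2 + (c / k) *\<^sub>c \<sigma> 3" for a b c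
      using k by (auto simp: fun_eq_iff cscale_def \<omega>1 \<omega>2 \<sigma>_simps(3) algebra_simps simp del: One_nat_def)
    have old: "a *\<^sub>c \<sigma> 1 + b *\<^sub>c \<sigma> 2 + c *\<^sub>c \<sigma> 3
        = ((a * s - b * r) / D) *\<^sub>c \<omega> 1 + ((b * p - a * q) / D) *\<^sub>c \<omega> 2 + (c * k) *\<^sub>c \<omega> 3" for a b c
      unfolding \<sigma>_simps by (auto simp: fun_eq_iff cscale_def algebra_simps diff_divide_distrib)
    have ind: "a = 0 \<and> b = 0 \<and> c = 0" if "a *\<^sub>c \<omega> 1 + b *\<^sub>c \<omega> 2 + c *\<^sub>c \<omega> 3 = 0" for a b c
      using \<omega> that unfolding presents_J_def basis_10_3_iff by blast
    have "a = 0 \<and> b = 0 \<and> c = 0" if "a *\<^sub>c \<sigma> 1 + b *\<^sub>c \<sigma> 2 + c *\<^sub>c \<sigma> 3 = 0" for a b c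
    proof -
      have "a * s - b * r = 0" "b * p - a * q = 0" "c = 0"
        using ind[OF that[unfolded old]] D k by auto
      moreover from this have "a * D = 0" "b * D = 0"
        unfolding D_def by algebra+
      ultimately show ?thesis
        using D by simp
    qed
    moreover have "forms_10 J = {a *\<^sub>c \<omega> 1 + b *\<^sub>c \<omega> 2 + c *\<^sub>c \<omega> 3 | a b c. True}"
      using \<omega> unfolding presents_J_def basis_10_3_iff by blast
    moreover have "\<dots> = {a *\<^sub>c \<sigma> 1 + b *\<^sub>c \<sigma> 2 + c *\<^sub>c \<sigma> 3 | a b c. True}"
      using new old by blast
    ultimately show ?thesis
      unfolding basis_10_3_iff by blast
  qed
  ultimately show ?thesis
    unfolding presents_J_def by blast
qed

theorem theorem4p13:
  fixes br :: "'a::real_vector \<Rightarrow> 'a \<Rightarrow> 'a" and J :: "'a \<Rightarrow> 'a"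
    and \<omega> :: "nat \<Rightarrow> 'a \<Rightarrow> complex" and M :: "complex^2^2"
  assumes "nilpotent_lie_algebra br" and "dim (UNIV :: 'a set) = 6"
    and "one_abelian br J 3"
    and "presents_J br J \<omega> M"
    and "invertible M"
    and "\<And>\<omega>' M'. presents_J br J \<omega>' M' \<Longrightarrow> \<not> hermitian_matrix M'"
  shows "\<exists>\<sigma>. basis_10 J 3 \<sigma> \<and> ce_d br (\<sigma> 1) = 0 \<and> ce_d br (\<sigma> 2) = 0 \<and>
    (ce_d br (\<sigma> 3) = wbar \<sigma> 1 2 + wbar \<sigma> 2 1 + \<i> *\<^sub>c wbar \<sigma> 2 2 \<or>
     (\<exists>\<mu>::real. 1 < \<mu> \<and> ce_d br (\<sigma> 3) = wbar \<sigma> 1 2 + complex_of_real \<mu> *\<^sub>c wbar \<sigma> 2 1) \<or>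
     (\<exists>\<theta>::real. 0 < \<theta> \<and> \<theta> < pi \<and>
        ce_d br (\<sigma> 3) = wbar \<sigma> 1 1 + exp (\<i> * complex_of_real \<theta>) *\<^sub>c wbar \<sigma> 2 2))"
proof -
  have "det M \<noteq> 0"
    using assms(5) by (simp add: invertible_det_nz)
  then obtain N where N: "scaled_congruent M N" "hermitian_matrix N \<or> normal_form N"
    using normal_form_exists by blast
  then obtain \<sigma> where \<sigma>: "presents_J br J \<sigma> N"
    using presents_J_change_basis assms(4) by blast
  then have nf: "normal_form N"
    using assms(6) N(2) by blast
  have zero: "0 *\<^sub>c f = 0" and one: "1 *\<^sub>c f = f" for f :: "'a \<times> 'a \<Rightarrow> complex"
    by (auto simp: cscale_def)
  from nf consider "N = mat2 0 1 1 \<i>"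
    | \<mu> :: real where "1 < \<mu>" "N = mat2 0 1 (complex_of_real \<mu>) 0"
    | \<theta> :: real where "0 < \<theta>" "\<theta> < pi" "N = mat2 1 0 0 (exp (\<i> * complex_of_real \<theta>))"
    unfolding normal_form_def by blast
  then show ?thesis
    using \<sigma> by cases (auto simp: presents_J_def zero one intro!: exI[of _ \<sigma>])
qed

end
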